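(* Let $k$ be an odd integer and let $l\ge 2$ be an even integer with $k\ge 2l+1$. Put $d=\frac{3k}{2}+\frac{l+1}{2}$. Then the maximum length of a symmetric circuit code $C\in\mathcal{F}(d,k,k+l)$ is exactly $4k+2l$.
   Context: $I(d)$ is the graph of the $d$-dimensional hypercube (vertices are binary vectors of length $d$; edges join vectors differing in exactly one position). For a graph $G$, $d_G(x,y)$ is the graph distance in $G$. A circuit in $I(d)$ is a simple cycle $C=(x_1,\ldots,x_N)$ in $I(d)$; its length is $|C|=N$. A $(d,k)$ circuit code (circuit code of spread $k$ in dimension $d$) is a circuit $C$ in $I(d)$ such that for all vertices $x,y$ of $C$, $d_{I(d)}(x,y)<k$ implies $d_C(x,y)=d_{I(d)}(x,y)$. The transition sequence of $C$ is $T=(\tau_1,\ldots,\tau_N)$, where $\tau_i\in\{1,\ldots,d\}$ is the position in which $x_i$ and $x_{i+1}$ differ (indices mod $N$, so $\tau_N$ is the position in which $x_N$ and $x_1$ differ). A segment of $T$ is a subsequence of cyclically consecutive elements of $T$. The maximum bit run $\phi(C)$ is the length of the longest segment of $T$ in which no transition is repeated. $\mathcal{F}(d,k,r)$ is the set of $(d,k)$ circuit codes $C$ with $\phi(C)\ge r$. A circuit code is symmetric if its transition sequence satisfies $\tau_i=\tau_{i+N/2}$ for $1\le i\le N/2$ ($N$ is always even since $I(d)$ is bipartite). *)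

theory Defs
  imports Complex_Main
begin

text \<open>
  A graph is given by its edge set, a symmetric irreflexive relation; walks of length \<open>n\<close> from
  \<open>x\<close> to \<open>y\<close> are then witnessed by \<open>(x, y) \<in> E ^^ n\<close>. The distance is only meaningful for
  vertices in the same component, which is always the case below.
\<close>

definition gdist :: "('a \<times> 'a) set \<Rightarrow> 'a \<Rightarrow> 'a \<Rightarrow> nat" where
  "gdist E x y = (LEAST n. (x, y) \<in> E ^^ n)"

definition hypercube :: "nat \<Rightarrow> (bool list \<times> bool list) set" where
  "hypercube d = {(u, v). length u = d \<and> length v = d \<and> (\<exists>!j. j < d \<and> u ! j \<noteq> v ! j)}"

text \<open>
  A cycle \<open>(x\<^sub>1, \<dots>, x\<^sub>N)\<close> is a list \<open>C\<close> with \<open>x\<^sub>i = C ! (i - 1)\<close>: indices run over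
  \<open>{0..<N}\<close> and are read modulo \<open>N\<close>.
\<close>

definition simple_cycle :: "('a \<times> 'a) set \<Rightarrow> 'a list \<Rightarrow> bool" where
  "simple_cycle E C \<longleftrightarrow> length C \<ge> 3 \<and> distinct C \<and>
     (\<forall>i < length C. (C ! i, C ! (Suc i mod length C)) \<in> E)"

definition cycle_graph :: "'a list \<Rightarrow> ('a \<times> 'a) set" where
  "cycle_graph C =
     (let S = {(C ! i, C ! (Suc i mod length C)) | i. i < length C} in S \<union> S\<inverse>)"

definition circuit_code :: "nat \<Rightarrow> nat \<Rightarrow> bool list list \<Rightarrow> bool" where
  "circuit_code d k C \<longleftrightarrow> simple_cycle (hypercube d) C \<and>
     (\<forall>x \<in> set C. \<forall>y \<in> set C.
        gdist (hypercube d) x y < k \<longrightarrow> gdist (cycle_graph C) x y = gdist (hypercube d) x y)"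

text \<open>Positions of a binary vector are numbered from \<open>0\<close>, so transitions lie in \<open>{0..<d}\<close>.\<close>

definition transition :: "bool list list \<Rightarrow> nat \<Rightarrow> nat" where
  "transition C i =
     (THE j. j < length (C ! i) \<and> (C ! i) ! j \<noteq> (C ! (Suc i mod length C)) ! j)"

definition transitions :: "bool list list \<Rightarrow> nat list" where
  "transitions C = map (transition C) [0..<length C]"

definition segments :: "'a list \<Rightarrow> 'a list set" where
  "segments T = {take m (rotate i T) | i m. True}"

definition max_bit_run :: "bool list list \<Rightarrow> nat" where
  "max_bit_run C = Max {length S | S. S \<in> segments (transitions C) \<and> distinct S}"

definition circuit_codes :: "nat \<Rightarrow> nat \<Rightarrow> nat \<Rightarrow> bool list list set" where
  "circuit_codes d k r = {C. circuit_code d k C \<and> max_bit_run C \<ge> r}"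

definition symmetric_code :: "bool list list \<Rightarrow> bool" where
  "symmetric_code C \<longleftrightarrow>
     (let T = transitions C; N = length T
      in \<forall>i < N div 2. T ! i = T ! (i + N div 2))"

end

theory Submission
  imports Defs
begin

text \<open>
  Let \<open>w\<close>, of length \<open>n\<close>, be half of the transition sequence of a symmetric code, read cyclically.
  The spread condition says that every window of length at most \<open>n\<close> is repetition-free or has at
  least \<open>k\<close> symbols of odd multiplicity; since \<open>k\<close> is odd, every \<open>k + 1\<close> consecutive transitions
  are distinct.

  Upper bound. Suppose \<open>n > 2k + l\<close> and let \<open>A\<close> be a bit run of length \<open>k + l\<close>, leaving \<open>(k - l + 1)/2\<close>
  symbols outside \<open>A\<close>. Counting shows that the \<open>k + 1\<close> transitions \<open>B\<close> after \<open>A\<close> contain all outside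
  symbols, with exactly \<open>k\<close> odd symbols in \<open>AB\<close>; likewise for the \<open>k + 1\<close> transitions before \<open>A\<close>.
  Extending the windows \<open>AB\<dots>\<close> and \<open>B\<dots>\<close> one step at a time, the two lower bounds force each new
  transition to be a symbol of \<open>A\<close>, so outside symbols occur only in \<open>B\<close>. Hence the last \<open>k + 1\<close>
  transitions of the period overlap \<open>B\<close>, and the entries of \<open>B\<close> before the overlap cancel against
  \<open>A\<close>, so there are at most \<open>l\<close> of them and \<open>n \<le> 2k + 2l + 1\<close>. If \<open>n = 2k + l + 1\<close>,
  deleting an outside symbol leaves too few odd symbols; otherwise the symbol after \<open>B\<close> occurs
  three times in the period, so \<open>n \<ge> 3k + 3\<close>,
  contradicting \<open>k \<ge> 2l + 1\<close>.

  Lower bound. A half-sequence of length \<open>2k + l\<close> in which \<open>(k + l - 1)/2\<close> symbols of the bit run are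
  repeated in the remaining \<open>k\<close> transitions in the same order works.
\<close>

section \<open>Distances in the hypercube and in a cycle\<close>

lemma gdist_eqI:
  assumes "(x, y) \<in> E ^^ n" and "\<And>r. (x, y) \<in> E ^^ r \<Longrightarrow> n \<le> r"
  shows "gdist E x y = n"
  unfolding gdist_def using assms by (rule Least_equality)

definition hamming :: "bool list \<Rightarrow> bool list \<Rightarrow> nat" where
  "hamming u v = card {j. j < length u \<and> u ! j \<noteq> v ! j}"

lemma hypercube_flipI:
  assumes "length u = d" "length v = d" "q < d"
    and "\<And>c. c < d \<Longrightarrow> v ! c \<longleftrightarrow> (u ! c \<noteq> (c = q))"
  shows "(u, v) \<in> hypercube d"
  unfolding hypercube_def using assms by auto

lemma hypercube_flipE:
  assumes "(u, v) \<in> hypercube d"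
  obtains q where "length u = d" "length v = d" "q < d"
    and "\<And>c. c < d \<Longrightarrow> v ! c \<longleftrightarrow> (u ! c \<noteq> (c = q))"
  using assms unfolding hypercube_def by auto

lemma hypercube_path_hamming_le:
  assumes "(u, v) \<in> hypercube d ^^ r" "length u = d"
  shows "length v = d \<and> hamming u v \<le> r"
  using assms
proof (induction r arbitrary: v)
  case 0
  then show ?case by (auto simp: hamming_def)
next
  case (Suc r)
  then obtain w where w: "(u, w) \<in> hypercube d ^^ r" "(w, v) \<in> hypercube d" by auto
  then have IH: "length w = d" "hamming u w \<le> r" using Suc by auto
  from w(2) obtain q where q: "length v = d" "q < d"
      "\<And>c. c < d \<Longrightarrow> v ! c \<longleftrightarrow> (w ! c \<noteq> (c = q))"
    by (rule hypercube_flipE) blast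
  have "{j. j < length u \<and> u ! j \<noteq> v ! j} \<subseteq> insert q {j. j < length u \<and> u ! j \<noteq> w ! j}"
    using q Suc.prems by auto
  then have "hamming u v \<le> card (insert q {j. j < length u \<and> u ! j \<noteq> w ! j})"
    unfolding hamming_def by (intro card_mono) auto
  also have "\<dots> \<le> Suc (hamming u w)"
    unfolding hamming_def by (rule card_insert_le_m1[THEN order_trans]) auto
  finally show ?case using IH q by simp
qed

lemma hypercube_path_hamming:
  assumes "length u = d" "length v = d"
  shows "(u, v) \<in> hypercube d ^^ hamming u v"
  using assms
proof (induction "hamming u v" arbitrary: v)
  case 0
  then have "u = v" by (auto simp: hamming_def intro: nth_equalityI)
  then show ?case using 0 by simp
next
  case (Suc r)
  let ?D = "\<lambda>v. {j. j < length u \<and> u ! j \<noteq> v ! j}"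
  have "?D v \<noteq> {}" using Suc(2) by (metis card.empty hamming_def nat.distinct(1))
  then obtain q where q: "q < d" "u ! q \<noteq> v ! q" using Suc.prems by auto
  define w where "w = v[q := u ! q]"
  have lw: "length w = d" using Suc.prems by (simp add: w_def)
  have "?D w = ?D v - {q}" using q Suc.prems by (auto simp: w_def nth_list_update)
  then have "hamming u w = r" using q Suc by (simp add: hamming_def)
  with Suc lw have "(u, w) \<in> hypercube d ^^ r" by metis
  moreover have "(w, v) \<in> hypercube d"
    using q Suc.prems lw by (intro hypercube_flipI[of _ _ _ q]) (auto simp: w_def nth_list_update)
  ultimately show ?case using Suc(2) by (metis relpow_Suc_I)
qed

lemma gdist_hypercube:
  assumes "length u = d" "length v = d"
  shows "gdist (hypercube d) u v = hamming u v"
  using assms hypercube_path_hamming hypercube_path_hamming_le by (intro gdist_eqI) auto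

text \<open>Each edge of the cycle moves the index by one in either direction, so the displacement
  is a signed integer; distinctness identifies vertices with indices.\<close>

lemma cycle_path_offset:
  assumes "(x, y) \<in> cycle_graph C ^^ r" "distinct C" "x = C ! (i mod length C)" "C \<noteq> []"
  shows "\<exists>z. \<bar>z\<bar> \<le> int r \<and> y = C ! nat ((int i + z) mod int (length C))"
  using assms
proof (induction r arbitrary: y)
  case 0
  then show ?case by (intro exI[of _ 0]) (auto simp: nat_mod_as_int)
next
  case (Suc r)
  let ?N = "length C"
  obtain w where w: "(x, w) \<in> cycle_graph C ^^ r" "(w, y) \<in> cycle_graph C" using Suc by auto
  then obtain z where z: "\<bar>z\<bar> \<le> int r" "w = C ! nat ((int i + z) mod int ?N)" using Suc by blast
  define a where "a = nat ((int i + z) mod int ?N)"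
  have N: "?N > 0" using Suc by simp
  have a: "a < ?N" "int a = (int i + z) mod int ?N" using N by (auto simp: a_def nat_less_iff)
  obtain b where b: "b < ?N" "w = C ! b \<and> y = C ! (Suc b mod ?N) \<or> y = C ! b \<and> w = C ! (Suc b mod ?N)"
    using w(2) unfolding cycle_graph_def Let_def by auto
  from b(2) show ?case
  proof
    assume *: "w = C ! b \<and> y = C ! (Suc b mod ?N)"
    then have "b = a" using z(2) a b Suc.prems(2) by (simp add: a_def[symmetric] nth_eq_iff_index_eq)
    then have "int (Suc b mod ?N) = (int i + (z + 1)) mod int ?N"
      using a(2) by (simp add: zmod_int mod_simps add_ac)
    then have "Suc b mod ?N = nat ((int i + (z + 1)) mod int ?N)" by (metis nat_int)
    then show ?thesis using * z(1) by (intro exI[of _ "z + 1"]) simp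
  next
    assume *: "y = C ! b \<and> w = C ! (Suc b mod ?N)"
    then have "Suc b mod ?N = a"
      using z(2) a b Suc.prems(2) N by (simp add: a_def[symmetric] nth_eq_iff_index_eq)
    then have "(int b + 1) mod int ?N = (int i + z) mod int ?N"
      using a(2) by (simp add: zmod_int flip: \<open>Suc b mod ?N = a\<close>) (simp add: add.commute)
    then have "(int b + 1 - 1) mod int ?N = (int i + z - 1) mod int ?N" by (rule mod_diff_cong) simp
    then have "int b = (int i + (z - 1)) mod int ?N" using b by (simp add: algebra_simps)
    then have "b = nat ((int i + (z - 1)) mod int ?N)" by (metis nat_int)
    then show ?thesis using * z(1) by (intro exI[of _ "z - 1"]) simp
  qed
qed

lemma cycle_graph_step:
  assumes "i < length C"
  shows "(C ! i, C ! (Suc i mod length C)) \<in> cycle_graph C"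
  unfolding cycle_graph_def Let_def using assms by (intro UnI1 CollectI exI[of _ i]) simp

lemma cycle_path_forward:
  assumes "C \<noteq> []"
  shows "(C ! (i mod length C), C ! ((i + r) mod length C)) \<in> cycle_graph C ^^ r"
proof (induction r)
  case (Suc r)
  have "(C ! ((i + r) mod length C), C ! (Suc ((i + r) mod length C) mod length C)) \<in> cycle_graph C"
    using assms by (intro cycle_graph_step) simp
  then have "(C ! ((i + r) mod length C), C ! ((i + Suc r) mod length C)) \<in> cycle_graph C"
    by (simp add: mod_Suc_eq)
  with Suc show ?case by (rule relpow_Suc_I)
qed simp

lemma gdist_sym:
  assumes "E\<inverse> = E"
  shows "gdist E x y = gdist E y x"
proof -
  have *: "(a, b) \<in> E ^^ n \<Longrightarrow> (b, a) \<in> E ^^ n" for a b n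
  proof (induction n arbitrary: b)
    case (Suc n)
    then obtain c where c: "(a, c) \<in> E ^^ n" "(c, b) \<in> E" by auto
    then have "(c, a) \<in> E ^^ n" "(b, c) \<in> E" using Suc assms by auto
    then show ?case by (metis relpow_Suc_I2)
  qed simp
  show ?thesis unfolding gdist_def using * by metis
qed

lemma gdist_cycle:
  assumes "distinct C" "C \<noteq> []" "2 * r \<le> length C"
  shows "gdist (cycle_graph C) (C ! (i mod length C)) (C ! ((i + r) mod length C)) = r"
proof (rule gdist_eqI)
  show "(C ! (i mod length C), C ! ((i + r) mod length C)) \<in> cycle_graph C ^^ r"
    using assms by (intro cycle_path_forward)
next
  fix r' assume r': "(C ! (i mod length C), C ! ((i + r) mod length C)) \<in> cycle_graph C ^^ r'"
  then obtain z where z: "\<bar>z\<bar> \<le> int r'"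
      "C ! ((i + r) mod length C) = C ! nat ((int i + z) mod int (length C))"
    using cycle_path_offset[OF r' assms(1) refl assms(2)] by blast
  have N: "length C > 0" using assms by simp
  have "(i + r) mod length C = nat ((int i + z) mod int (length C))"
    using z(2) assms(1) N by (subst (asm) nth_eq_iff_index_eq) (auto simp: nat_less_iff)
  then have "int ((i + r) mod length C) = (int i + z) mod int (length C)"
    using N by simp
  then have "(int i + int r) mod int (length C) = (int i + z) mod int (length C)"
    by (metis of_nat_add of_nat_mod)
  then have dv: "int (length C) dvd int r - z" by (simp add: mod_eq_dvd_iff)
  show "r \<le> r'"
  proof (rule ccontr)
    assume "\<not> r \<le> r'"
    \<comment> \<open>A walk shorter than \<open>r\<close> has |z| < r, so 0 < r - z < 2r, and 2r is
      at most the length.\<close>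
    then have "0 < int r - z" "int r - z < int (length C)" using z(1) assms(3) by auto
    then show False using dv zdvd_not_zless by blast
  qed
qed

section \<open>Symbols of odd multiplicity in a window\<close>

text \<open>For a transition sequence these are the coordinates in which the two ends of the window
  differ, so the cardinality is a Hamming distance.\<close>

primrec oddset :: "(nat \<Rightarrow> 'a) \<Rightarrow> nat \<Rightarrow> nat \<Rightarrow> 'a set" where
  "oddset s i 0 = {}"
| "oddset s i (Suc r) = sym_diff (oddset s i r) {s (i + r)}"

lemma oddset_subset: "oddset s i r \<subseteq> s ` {i..<i + r}"
  by (induction r) (auto simp: atLeastLessThanSuc)

lemma finite_oddset [simp]: "finite (oddset s i r)"
  by (rule finite_subset[OF oddset_subset]) simp

lemma oddset_add: "oddset s i (a + b) = sym_diff (oddset s i a) (oddset s (i + a) b)"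
  by (induction b) (auto simp: add.assoc)

lemma oddset_shift: "oddset (\<lambda>j. s (a + j)) i r = oddset s (a + i) r"
  by (induction r) (auto simp: add.assoc)

lemmas oddset_Suc = oddset.simps(2)

declare oddset_Suc [simp del]

lemma card_sym_diff_singleton:
  assumes "finite A"
  shows "card (sym_diff A {x}) = (if x \<in> A then card A - 1 else Suc (card A))"
proof -
  have "sym_diff A {x} = (if x \<in> A then A - {x} else insert x A)" by auto
  then show ?thesis using assms by (auto simp: card_insert_disjoint)
qed

lemma card_oddset_Suc:
  "card (oddset s i (Suc r)) =
     (if s (i + r) \<in> oddset s i r then card (oddset s i r) - 1 else Suc (card (oddset s i r)))"
  using card_sym_diff_singleton[OF finite_oddset] by (simp add: oddset_Suc)

text \<open>Every step changes the cardinality by exactly one.\<close>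

lemma even_card_oddset: "even (card (oddset s i r)) \<longleftrightarrow> even r"
proof (induction r)
  case (Suc r)
  have "card (oddset s i r) > 0" if "s (i + r) \<in> oddset s i r"
    using that by (metis card_gt_0_iff empty_iff finite_oddset)
  then show ?case using Suc by (auto simp: card_oddset_Suc)
qed simp

lemma oddset_inj: "inj_on s {i..<i + r} \<Longrightarrow> oddset s i r = s ` {i..<i + r}"
proof (induction r)
  case (Suc r)
  have "inj_on s {i..<i + r}" by (rule inj_on_subset[OF Suc.prems]) auto
  then have "oddset s i r = s ` {i..<i + r}" by (rule Suc.IH)
  moreover have "s (i + r) \<notin> s ` {i..<i + r}"
    using inj_onD[OF Suc.prems, of "i + r"] by fastforce
  ultimately show ?case by (auto simp: oddset_Suc atLeastLessThanSuc)
qed simp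

lemma inj_if_card_oddset:
  assumes "card (oddset s i r) = r"
  shows "inj_on s {i..<i + r}"
proof (rule eq_card_imp_inj_on)
  have "r \<le> card (s ` {i..<i + r})"
    using card_mono[OF _ oddset_subset[of s i r]] assms by simp
  then show "card (s ` {i..<i + r}) = card {i..<i + r}"
    using card_image_le[of "{i..<i + r}" s] by simp
qed simp

lemma card_oddset_le: "card (oddset s i r) \<le> r"
  using card_mono[OF _ oddset_subset[of s i r]] card_image_le[of "{i..<i + r}" s] by simp

text \<open>Cutting the window of length q + n at q or at n gives two decompositions; the pieces of
  length q agree by periodicity and cancel.\<close>

lemma oddset_rotate:
  assumes "\<And>i. s (i + n) = s i"
  shows "oddset s q n = oddset s 0 n"
proof -
  have "oddset s n q = oddset s 0 q"
    using oddset_shift[of s n 0 q] assms by (simp add: add.commute)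
  then show ?thesis
    using oddset_add[of s 0 q n] oddset_add[of s 0 n q] by (auto simp: add.commute)
qed

text \<open>The counting that drives the upper bound: \<open>S\<close> is the set of symbols of a long bit run and
  \<open>B\<close> that of the \<open>k + 1\<close> transitions right before or after it.\<close>

lemma block_exhausts_rest:
  fixes d k l :: nat
  assumes d: "2 * d = 3 * k + l + 1" and "odd k"
    and S: "S \<subseteq> {..<d}" "card S = k + l"
    and B: "B \<subseteq> {..<d}" "card B = k + 1"
    and ge: "card (sym_diff S B) \<ge> k"
  shows "{..<d} - S \<subseteq> B" and "card (sym_diff S B) = k"
proof -
  have fin: "finite S" "finite B" using S B finite_subset by auto
  have 1: "card (sym_diff S B) = card (S - B) + card (B - S)"
    using fin by (intro card_Un_disjoint) auto
  have 2: "card (S - B) + card (S \<inter> B) = k + l" "card (B - S) + card (S \<inter> B) = k + 1"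
    using fin S B card_Int_Diff[of S B] card_Int_Diff[of B S] by (auto simp: Int_commute)
  have 3: "card ({..<d} - S) = d - (k + l)" using S by (simp add: card_Diff_subset fin)
  have sub: "B - S \<subseteq> {..<d} - S" using B by auto
  then have 4: "card (B - S) \<le> d - (k + l)" using 3 card_mono[OF _ sub] by simp
  have "k + l \<le> d" using S by (metis card_lessThan card_mono finite_lessThan)
  \<comment> \<open>With c = card (B - S), the symmetric difference has l - 1 + 2c elements, and c
    <= d - (k + l) = (k - l + 1)/2 caps this at k, so the lower bound \<open>ge\<close> forces
    equality.\<close>
  then have eq: "card (B - S) = card ({..<d} - S)" and "card (sym_diff S B) = k"
    using 1 2 3 4 ge d by linarith+
  then show "card (sym_diff S B) = k" by simp
  show "{..<d} - S \<subseteq> B" using card_subset_eq[OF _ sub eq] by auto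
qed

section \<open>Upper bound on the period of the transition sequence\<close>

lemma long_bit_run_period_bound:
  fixes s :: "nat \<Rightarrow> nat" and d k l n :: nat
  assumes k: "odd k" and l: "even l" and l2: "l \<ge> 2" and kl: "k \<ge> 2 * l + 1"
    and d: "2 * d = 3 * k + l + 1"
    and s_less: "\<And>i. s i < d"
    and per: "\<And>i. s (i + n) = s i"
    and spread: "\<And>i r. r \<le> n \<Longrightarrow> card (oddset s i r) < k \<Longrightarrow> card (oddset s i r) = r"
    and run: "inj_on s {0..<k + l}"
  shows "n \<le> 2 * k + l"
proof (rule ccontr)
  assume "\<not> n \<le> 2 * k + l"
  define m where "m = k + l"
  have n: "n \<ge> m + k + 1" using \<open>\<not> n \<le> 2 * k + l\<close> by (simp add: m_def)
  have ge: "card (oddset s i r) \<ge> k" if "k \<le> r" "r \<le> n" for i r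
    using spread[of r i] that by linarith
  \<comment> \<open>An even window has an even number of odd symbols, so at least \<open>k\<close>
    means at least \<open>k + 1\<close>.\<close>
  have inj: "inj_on s {i..<i + (k + 1)}" for i
  proof (rule inj_if_card_oddset)
    have "card (oddset s i (k + 1)) \<noteq> k" using even_card_oddset[of s i "k + 1"] k by auto
    then show "card (oddset s i (k + 1)) = k + 1"
      using ge[of "k + 1" i] card_oddset_le[of s i "k + 1"] n m_def by linarith
  qed
  have far: "j \<ge> i + (k + 1)" if "i < j" "s i = s j" for i j
  proof (rule ccontr)
    assume "\<not> j \<ge> i + (k + 1)"
    then have "i = j" using inj_onD[OF inj[of i] that(2)] that by auto
    then show False using that by simp
  qed
  define S where "S = s ` {0..<m}"
  define B where "B = s ` {m..<m + (k + 1)}"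
  define R where "R = {..<d} - S"
  have run': "inj_on s {0..<m}" using run by (simp add: m_def)
  have cS: "S \<subseteq> {..<d}" "card S = k + l" "finite S"
    using s_less card_image[OF run'] by (auto simp: S_def m_def)
  have oS: "oddset s 0 m = S" using oddset_inj[of s 0 m] run' by (simp add: S_def)
  have oB: "oddset s m (k + 1) = B" using oddset_inj[OF inj] by (simp add: B_def)
  have cB: "B \<subseteq> {..<d}" "card B = k + 1"
    using s_less card_image[OF inj] by (auto simp: B_def)
  have split: "oddset s 0 (m + r) = sym_diff S (oddset s m r)" for r
    using oddset_add[of s 0 m r] oS by simp
  have "card (sym_diff S B) \<ge> k" using ge[of "m + (k + 1)" 0] n unfolding split oB by simp
  note after = block_exhausts_rest[OF d k cS(1,2) cB this]
  have RB: "R \<subseteq> B" using after(1) by (simp add: R_def)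
  have "card R = d - (k + l)" using cS by (simp add: R_def card_Diff_subset)
  then have "R \<noteq> {}" using d kl by (intro notI) simp
  define B' where "B' = s ` {n - (k + 1)..<n}"
  have nk: "n - (k + 1) + (k + 1) = n" using n by simp
  \<comment> \<open>Mirror image of \<open>RB\<close>: the last k + 1 transitions of the period are
    followed by the next copy of the run.\<close>
  have RB': "R \<subseteq> B'"
  proof -
    have inj': "inj_on s {n - (k + 1)..<n}" using inj[of "n - (k + 1)"] nk by simp
    have oB': "oddset s (n - (k + 1)) (k + 1) = B'"
      using oddset_inj[OF inj, of "n - (k + 1)"] nk by (simp only: B'_def)
    have "oddset s n m = S"
      using oddset_shift[of s n 0 m] per oS by (simp add: add.commute)
    then have "oddset s (n - (k + 1)) ((k + 1) + m) = sym_diff S B'"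
      using oddset_add[of s "n - (k + 1)" "k + 1" m] oB' nk by auto
    then have "card (sym_diff S B') \<ge> k" using ge[of "(k + 1) + m" "n - (k + 1)"] n by simp
    moreover have "B' \<subseteq> {..<d}" "card B' = k + 1"
      using s_less card_image[OF inj'] n by (auto simp: B'_def)
    ultimately show ?thesis
      using block_exhausts_rest[OF d k cS(1,2)] by (simp add: R_def)
  qed
  have walk: "R \<subseteq> oddset s m (k + 1 + j) \<and> (\<forall>i<j. s (m + (k + 1) + i) \<notin> R) \<and>
      card (oddset s m (k + 1 + j)) = (if even j then k + 1 else k) \<and>
      card (oddset s 0 (m + (k + 1 + j))) = (if even j then k else k + 1)"
    if "m + (k + 1) + j \<le> n" for j
    using that
  proof (induction j)
    case 0
    then show ?case using RB oB after(2) cB split[of "k + 1"] by simp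
  next
    case (Suc j)
    define F where "F = oddset s 0 (m + (k + 1 + j))"
    define G where "G = oddset s m (k + 1 + j)"
    define x where "x = s (m + (k + 1 + j))"
    have IH: "R \<subseteq> G" "\<forall>i<j. s (m + (k + 1) + i) \<notin> R"
        "card G = (if even j then k + 1 else k)" "card F = (if even j then k else k + 1)"
      using Suc by (simp_all add: F_def G_def)
    have FG: "F = sym_diff S G" unfolding F_def G_def by (rule split)
    have geF: "k \<le> card (sym_diff F {x})" and geG: "k \<le> card (sym_diff G {x})"
      using ge[of "Suc (m + (k + 1 + j))" 0] ge[of "Suc (k + 1 + j)" m] Suc.prems
      by (simp_all add: F_def G_def x_def oddset_Suc)
    have cF: "card (sym_diff F {x}) = (if x \<in> F then card F - 1 else Suc (card F))"
      and cG: "card (sym_diff G {x}) = (if x \<in> G then card G - 1 else Suc (card G))"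
      by (simp_all only: F_def G_def card_sym_diff_singleton finite_oddset)
    have k0: "k > 0" using kl by simp
    have xd: "x < d" using s_less by (simp add: x_def)
    \<comment> \<open>The window whose count is exactly \<open>k\<close> cannot lose a symbol, so it
      omits \<open>x\<close>. For even j it is \<open>F\<close>, for odd j it is \<open>G\<close>,
      and both contain \<open>R\<close>. Hence \<open>x\<close> lies in \<open>S\<close>, and
      \<open>FG\<close> decides its status in the other window.\<close>
    have x: "x \<notin> R \<and> (if even j then x \<notin> F \<and> x \<in> G else x \<in> F \<and> x \<notin> G)"
    proof (cases "even j")
      case True
      then have "x \<notin> F" using geF cF IH(4) k0 by (auto split: if_splits)
      then show ?thesis using True FG IH(1) xd by (auto simp: R_def)
    next
      case False
      then have "x \<notin> G" using geG cG IH(3) k0 by (auto split: if_splits)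
      then show ?thesis using False FG IH(1) xd by (auto simp: R_def)
    qed
    have "oddset s m (k + 1 + Suc j) = sym_diff G {x}"
        "oddset s 0 (m + (k + 1 + Suc j)) = sym_diff F {x}"
      using oddset_Suc[of s m "k + 1 + j"] oddset_Suc[of s 0 "m + (k + 1 + j)"]
      by (simp_all add: F_def G_def x_def)
    moreover have "\<forall>i<Suc j. s (m + (k + 1) + i) \<notin> R"
      using IH(2) x by (auto simp: less_Suc_eq x_def add.assoc)
    ultimately show ?case using x IH(1,3,4) cF cG by auto
  qed
  define z where "z = n - (m + (k + 1))"
  have nz: "n = m + (k + 1) + z" using n by (simp add: z_def)
  have late: "s i \<notin> R" if "m + (k + 1) \<le> i" "i < n" for i
    using walk[of z] that nz by (auto dest!: spec[of _ "i - (m + (k + 1))"])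
  have "z > 0"
  proof (rule ccontr)
    assume "\<not> z > 0"
    then have z: "z = 0" by simp
    obtain x where "x \<in> R" using \<open>R \<noteq> {}\<close> by auto
    then have "x \<in> B" using RB by auto
    then obtain q where q: "s q = x" by (auto simp: B_def)
    have F: "x \<in> oddset s 0 n" "card (oddset s 0 n) = k"
      using \<open>x \<in> R\<close> \<open>x \<in> B\<close> split[of "k + 1"] oB after(2) nz z by (auto simp: R_def)
    \<comment> \<open>Rotating the period to start at an occurrence of the outside symbol
      \<open>x\<close> and dropping that transition leaves only k - 1 odd symbols.\<close>
    have "oddset s q n = sym_diff (oddset s q 1) (oddset s (q + 1) (n - 1))"
      using oddset_add[of s q 1 "n - 1"] n by simp
    moreover have "oddset s q 1 = {x}" using q by (simp add: oddset_Suc)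
    ultimately have "oddset s (q + 1) (n - 1) = sym_diff (oddset s 0 n) {x}"
      using oddset_rotate[of s n q] per by auto
    then have "card (oddset s (q + 1) (n - 1)) = k - 1"
      using F card_sym_diff_singleton[of "oddset s 0 n" x] by simp
    moreover have "k \<le> n - 1" using n by simp
    ultimately show False using ge[of "n - 1" "q + 1"] kl by simp
  qed
  have "z \<le> l"
  proof (rule ccontr)
    assume "\<not> z \<le> l"
    \<comment> \<open>The first \<open>y\<close> entries of \<open>B\<close> precede the last k + 1
      transitions of the period. An outside symbol among them would, by \<open>RB'\<close> and
      \<open>late\<close>, recur within \<open>B\<close>, contradicting \<open>far\<close>. So all
      of them cancel against the run, leaving m - y < k odd symbols.\<close>
    define y where "y = min z (k + 1)"
    have y: "y \<le> z" "y \<le> k + 1" "y > l" using \<open>\<not> z \<le> l\<close> kl by (auto simp: y_def)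
    have "s i \<in> S" if i: "m \<le> i" "i < m + y" for i
    proof (rule ccontr)
      assume "s i \<notin> S"
      then have "s i \<in> R" using s_less by (simp add: R_def)
      then obtain i' where i': "n - (k + 1) \<le> i'" "i' < n" "s i' = s i"
        using RB' by (force simp: B'_def)
      have ltn: "i < n - (k + 1)" using i y nz by simp
      have "i' < m + (k + 1)" using late[of i'] i' \<open>s i \<in> R\<close> by (metis not_le)
      then show False using far[of i i'] i i' ltn by simp
    qed
    then have sub: "s ` {m..<m + y} \<subseteq> S" by auto
    have injy: "inj_on s {m..<m + y}" by (rule inj_on_subset[OF inj[of m]]) (use y in auto)
    then have "oddset s 0 (m + y) = S - s ` {m..<m + y}"
      using split[of y] oddset_inj[OF injy] sub by auto
    then have "card (oddset s 0 (m + y)) = m - y"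
      using sub cS card_image[OF injy] by (simp add: card_Diff_subset m_def)
    then show False using ge[of "m + y" 0] y nz kl by (simp add: m_def)
  qed
  text \<open>The symbol following \<open>B\<close> occurs three times in one period.\<close>
  define x where "x = s (m + (k + 1))"
  \<comment> \<open>Appending \<open>x\<close> raises the count from k to k + 1, so \<open>x\<close>
    has even multiplicity before; being in \<open>S\<close>, it also lies in
    \<open>B\<close>.\<close>
  have "card (oddset s 0 (Suc (m + (k + 1)))) = k + 1" "card (oddset s 0 (m + (k + 1))) = k"
    using walk[of 1] walk[of 0] \<open>z > 0\<close> nz by simp_all
  moreover have "card (oddset s 0 (Suc (m + (k + 1)))) = card (oddset s 0 (m + (k + 1))) - 1"
    if "x \<in> oddset s 0 (m + (k + 1))"
    using card_oddset_Suc[of s 0 "m + (k + 1)"] that unfolding x_def by (simp only: if_True add_0)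
  ultimately have "x \<notin> oddset s 0 (m + (k + 1))" by linarith
  then have "x \<notin> sym_diff S B" unfolding split oB .
  moreover have "x \<in> S"
    using late[of "m + (k + 1)"] \<open>z > 0\<close> nz s_less by (simp add: R_def x_def)
  ultimately have "x \<in> S" "x \<in> B" by auto
  then obtain p q where p: "p < m" "s p = x" and q: "m \<le> q" "q < m + (k + 1)" "s q = x"
    by (auto simp: S_def B_def)
  \<comment> \<open>The occurrences p, q, m + (k + 1), p + n are successively at least k + 1 apart,
    so n >= 3k + 3, whereas n = 2k + l + 1 + z <= 2k + 2l + 1.\<close>
  have "q \<ge> p + (k + 1)" using far[of p q] p q by simp
  moreover have "m + (k + 1) \<ge> q + (k + 1)" using far[of q "m + (k + 1)"] q by (simp add: x_def)
  moreover have "p + n \<ge> m + (k + 1) + (k + 1)"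
    using far[of "m + (k + 1)" "p + n"] per[of p] p(2) nz \<open>z > 0\<close> by (simp add: x_def)
  ultimately show False using nz \<open>z \<le> l\<close> kl by (simp add: m_def)
qed

section \<open>Transition sequences of circuit codes\<close>

lemma transition_eqI:
  assumes "q < length (C ! i)"
    and "\<And>c. c < length (C ! i) \<Longrightarrow> C ! (Suc i mod length C) ! c \<longleftrightarrow> (C ! i ! c \<noteq> (c = q))"
  shows "transition C i = q"
  unfolding transition_def using assms by (intro the_equality) auto

lemma hamming_commute: "length u = length v \<Longrightarrow> hamming u v = hamming v u"
  unfolding hamming_def by (rule arg_cong[where f = card]) auto

lemma simple_cycle_transition:
  assumes "simple_cycle (hypercube d) C" "i < length C"
  shows "length (C ! i) = d" "transition C i < d"
    and "c < d \<Longrightarrow> C ! (Suc i mod length C) ! c \<longleftrightarrow> (C ! i ! c \<noteq> (c = transition C i))"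
proof -
  have "(C ! i, C ! (Suc i mod length C)) \<in> hypercube d"
    using assms by (simp add: simple_cycle_def)
  then obtain q where q: "length (C ! i) = d" "q < d"
      "\<And>c. c < d \<Longrightarrow> C ! (Suc i mod length C) ! c \<longleftrightarrow> (C ! i ! c \<noteq> (c = q))"
    by (rule hypercube_flipE) blast
  moreover from this have "transition C i = q" by (intro transition_eqI) auto
  ultimately show "length (C ! i) = d" "transition C i < d"
    "c < d \<Longrightarrow> C ! (Suc i mod length C) ! c \<longleftrightarrow> (C ! i ! c \<noteq> (c = transition C i))" by auto
qed

lemma simple_cycle_nth_oddset:
  assumes "simple_cycle (hypercube d) C" and s: "s = (\<lambda>i. transition C (i mod length C))"
    and c: "c < d"
  shows "C ! ((i + r) mod length C) ! c \<longleftrightarrow> (C ! (i mod length C) ! c \<noteq> (c \<in> oddset s i r))"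
proof (induction r)
  case (Suc r)
  let ?N = "length C"
  have "(i + r) mod ?N < ?N" using assms(1) by (auto simp: simple_cycle_def intro: mod_less_divisor)
  from simple_cycle_transition(3)[OF assms(1) this c]
  have "C ! ((i + Suc r) mod ?N) ! c \<longleftrightarrow> (C ! ((i + r) mod ?N) ! c \<noteq> (c = s (i + r)))"
    by (simp add: mod_Suc_eq s)
  then show ?case using Suc by (auto simp: oddset_Suc)
qed simp

lemma simple_cycle_hamming:
  assumes "simple_cycle (hypercube d) C" and s: "s = (\<lambda>i. transition C (i mod length C))"
  shows "hamming (C ! (i mod length C)) (C ! ((i + r) mod length C)) = card (oddset s i r)"
proof -
  have N: "length C > 0" using assms by (auto simp: simple_cycle_def)
  then have l: "length (C ! (i mod length C)) = d"
    using simple_cycle_transition(1)[OF assms(1)] by simp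
  have "s j < d" for j using simple_cycle_transition(2)[OF assms(1)] N by (simp add: s)
  then have sub: "oddset s i r \<subseteq> {..<d}" using oddset_subset[of s i r] by auto
  have "{j. j < d \<and> C ! (i mod length C) ! j \<noteq> C ! ((i + r) mod length C) ! j} = oddset s i r"
    using simple_cycle_nth_oddset[OF assms, of _ i r] sub by auto
  then show ?thesis by (simp add: hamming_def l)
qed

lemma even_length_simple_cycle:
  assumes "simple_cycle (hypercube d) C"
  shows "even (length C)"
proof -
  have "hamming (C ! (0 mod length C)) (C ! ((0 + length C) mod length C)) = 0"
    by (simp add: hamming_def)
  then show ?thesis
    using simple_cycle_hamming[OF assms refl, of 0 "length C"] even_card_oddset by (metis even_zero)
qed

text \<open>An arc of at most half the cycle is a shortest path, so the spread condition becomes a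
  statement about windows.\<close>

lemma circuit_code_spread:
  assumes "circuit_code d k C" and s: "s = (\<lambda>i. transition C (i mod length C))"
    and "2 * r \<le> length C" "card (oddset s i r) < k"
  shows "card (oddset s i r) = r"
proof -
  let ?N = "length C"
  let ?x = "C ! (i mod ?N)" and ?y = "C ! ((i + r) mod ?N)"
  have cyc: "simple_cycle (hypercube d) C" using assms(1) by (simp add: circuit_code_def)
  then have N: "?N > 0" "distinct C" by (auto simp: simple_cycle_def)
  have "gdist (hypercube d) ?x ?y = card (oddset s i r)"
    using simple_cycle_hamming[OF cyc s] simple_cycle_transition(1)[OF cyc] N
    by (simp add: gdist_hypercube)
  moreover have "gdist (cycle_graph C) ?x ?y = r" using N assms(3) by (intro gdist_cycle) auto
  moreover have "?x \<in> set C" "?y \<in> set C" using N by simp_all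
  ultimately show ?thesis using assms(1,4) unfolding circuit_code_def by metis
qed

lemma finite_bit_runs: "finite {length S | S. S \<in> segments T \<and> distinct S}"
proof (rule finite_subset)
  show "{length S | S. S \<in> segments T \<and> distinct S} \<subseteq> {..length T}"
    by (auto simp: segments_def)
qed simp

lemma bit_run_in_period:
  assumes "r \<le> max_bit_run C" "C \<noteq> []" and s: "s = (\<lambda>i. transition C (i mod length C))"
  obtains a where "inj_on s {a..<a + r}"
proof -
  let ?M = "{length S | S. S \<in> segments (transitions C) \<and> distinct S}"
  \<comment> \<open>The empty segment makes the set nonempty, so the maximum is attained.\<close>
  have "length [] \<in> ?M"
    unfolding segments_def by (intro CollectI exI[of _ "[]"]) (auto intro!: exI[of _ 0])
  then have "max_bit_run C \<in> ?M" unfolding max_bit_run_def using finite_bit_runs Max_in by blast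
  then obtain S where S: "S \<in> segments (transitions C)" "distinct S" "length S \<ge> r"
    using assms(1) by auto
  then obtain p a where p: "S = take p (rotate a (transitions C))" by (auto simp: segments_def)
  have len: "length S \<le> length C" "length S \<le> p" using p by (auto simp: transitions_def)
  have nth: "S ! j = s (a + j)" if "j < length S" for j
  proof -
    have "(a + j) mod length C < length C" using assms(2) by simp
    then show ?thesis using that len p by (simp add: nth_rotate transitions_def s)
  qed
  have "inj_on s {a..<a + r}"
  proof (rule inj_onI)
    fix x y assume xy: "x \<in> {a..<a + r}" "y \<in> {a..<a + r}" "s x = s y"
    then have "S ! (x - a) = S ! (y - a)" using nth[of "x - a"] nth[of "y - a"] S(3) by auto
    moreover have "x - a < length S" "y - a < length S" using xy S(3) by auto
    ultimately have "x - a = y - a" using S(2) by (simp add: nth_eq_iff_index_eq)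
    then show "x = y" using xy by auto
  qed
  then show thesis by (rule that)
qed

text \<open>Symmetry makes half the length a period of the transitions; starting the sequence at the
  bit run gives the setting of \<open>long_bit_run_period_bound\<close>.\<close>

lemma symmetric_code_length_le:
  fixes d k l :: nat
  assumes "odd k" "even l" "l \<ge> 2" "k \<ge> 2 * l + 1" and d: "2 * d = 3 * k + l + 1"
    and C: "C \<in> circuit_codes d k (k + l)" and sym: "symmetric_code C"
  shows "length C \<le> 4 * k + 2 * l"
proof -
  have code: "circuit_code d k C" and run: "k + l \<le> max_bit_run C"
    using C by (auto simp: circuit_codes_def)
  then have cyc: "simple_cycle (hypercube d) C" by (simp add: circuit_code_def)
  then have ne: "C \<noteq> []" by (auto simp: simple_cycle_def)
  obtain n where n: "length C = 2 * n" using even_length_simple_cycle[OF cyc] by (rule evenE)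
  then have n0: "n > 0" using ne by (cases n) auto
  define s where "s = (\<lambda>i. transition C (i mod length C))"
  have s_less: "s i < d" for i
    using simple_cycle_transition(2)[OF cyc] ne by (simp add: s_def)
  have half: "transition C (i + n) = transition C i" if "i < n" for i
    using sym that n by (auto simp: symmetric_code_def Let_def transitions_def)
  have per: "s (i + n) = s i" for i
  proof (cases "i mod (2 * n) < n")
    case True
    have "(i + n) mod (2 * n) = (i mod (2 * n) + n) mod (2 * n)" by (simp add: mod_simps)
    then have "(i + n) mod (2 * n) = i mod (2 * n) + n" using True by simp
    then show ?thesis using half[OF True] by (simp add: s_def n)
  next
    case False
    define j where "j = i mod (2 * n) - n"
    have "i mod (2 * n) < 2 * n" using n0 by (intro mod_less_divisor) simp
    then have j: "i mod (2 * n) = j + n" "j < n" using False unfolding j_def by linarith+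
    have "(i + n) mod (2 * n) = (i mod (2 * n) + n) mod (2 * n)" by (simp add: mod_simps)
    also have "\<dots> = j" using j by (simp add: add.assoc flip: mult_2)
    finally show ?thesis using half[of j] j by (simp add: s_def n)
  qed
  obtain a where a: "inj_on s {a..<a + (k + l)}" using bit_run_in_period[OF run ne s_def] .
  have "n \<le> 2 * k + l"
  proof (rule long_bit_run_period_bound[of k l d "\<lambda>i. s (a + i)" n])
    fix i r assume r: "r \<le> n" "card (oddset (\<lambda>i. s (a + i)) i r) < k"
    show "card (oddset (\<lambda>i. s (a + i)) i r) = r"
      using circuit_code_spread[OF code s_def, of r "a + i"] r n by (simp add: oddset_shift)
  next
    show "inj_on (\<lambda>i. s (a + i)) {0..<k + l}"
    proof (rule inj_onI)
      fix x y assume "x \<in> {0..<k + l}" "y \<in> {0..<k + l}" "s (a + x) = s (a + y)"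
      then show "x = y" using inj_onD[OF a, of "a + x" "a + y"] by simp
    qed
  next
    show "s (a + (i + n)) = s (a + i)" for i using per[of "a + i"] by (simp add: add.assoc)
  qed (use assms s_less in auto)
  then show ?thesis using n by simp
qed

section \<open>A symmetric code with a long bit run\<close>

text \<open>One of the two arcs between the indices has length at most \<open>n\<close>; its
  orientation decides which index is \<open>a\<close>.\<close>

lemma cyclic_offset:
  fixes n :: nat
  assumes "i < 2 * n" "j < 2 * n"
  obtains a b r where "a = i \<and> b = j \<or> a = j \<and> b = i" "r \<le> n" "a < 2 * n" "b = (a + r) mod (2 * n)"
proof -
  note choose = that
  have *: thesis if "x \<le> y" "y < 2 * n" "x = i \<and> y = j \<or> x = j \<and> y = i" for x y
  proof (cases "y - x \<le> n")
    case True
    then show thesis using that by (intro choose[of x y "y - x"]) auto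
  next
    case False
    then show thesis using that by (intro choose[of y x "2 * n - (y - x)"]) auto
  qed
  show thesis using *[of i j] *[of j i] assms by (cases "i \<le> j") auto
qed

text \<open>Converse of \<open>circuit_code_spread\<close>: by \<open>cyclic_offset\<close> and
  symmetry of both distances, forward arcs of at most half the cycle cover all pairs.\<close>

lemma circuit_codeI:
  assumes cyc: "simple_cycle (hypercube d) C"
    and spread: "\<And>i r. i < length C \<Longrightarrow> 2 * r \<le> length C \<Longrightarrow>
      hamming (C ! i) (C ! ((i + r) mod length C)) = r \<or> k \<le> hamming (C ! i) (C ! ((i + r) mod length C))"
  shows "circuit_code d k C"
  unfolding circuit_code_def
proof (intro conjI ballI impI cyc)
  fix x y assume xy: "x \<in> set C" "y \<in> set C" and lt: "gdist (hypercube d) x y < k"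
  obtain i j where ij: "i < length C" "j < length C" "x = C ! i" "y = C ! j"
    using xy by (auto simp: in_set_conv_nth)
  have len: "length u = d" if "u \<in> set C" for u
    using that simple_cycle_transition(1)[OF cyc] by (auto simp: in_set_conv_nth)
  have ne: "C \<noteq> []" "distinct C" using cyc by (auto simp: simple_cycle_def)
  obtain n where n: "length C = 2 * n" using even_length_simple_cycle[OF cyc] by (rule evenE)
  obtain a b r where ab: "a = i \<and> b = j \<or> a = j \<and> b = i" "r \<le> n" "a < 2 * n" "b = (a + r) mod (2 * n)"
    using cyclic_offset[of i n j] ij(1,2) n by metis
  have "gdist (cycle_graph C) (C ! a) (C ! b) = r"
    using gdist_cycle[OF ne(2,1), of r a] ab n by simp
  moreover have "(cycle_graph C)\<inverse> = cycle_graph C" by (auto simp: cycle_graph_def Let_def)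
  ultimately have cg: "gdist (cycle_graph C) x y = r" using ab(1) ij gdist_sym by metis
  have h: "gdist (hypercube d) x y = hamming x y" using len xy by (intro gdist_hypercube)
  have "hamming x y = hamming (C ! a) (C ! b)"
    using ab(1) ij hamming_commute len xy by metis
  then have "hamming x y = r \<or> k \<le> hamming x y" using spread[of a r] ab n by simp
  then show "gdist (cycle_graph C) x y = gdist (hypercube d) x y" using cg h lt by simp
qed

lemma half_bounds: "a div 2 + (a + 1) div 2 = a" "a div 2 \<le> (a + 1) div 2" "(a + 1) div 2 \<le> a div 2 + 1"
  for a :: nat
  by presburger+

text \<open>
  Half of the transition sequence, of length \<open>half = run + k\<close>, consists of a bit run of length
  \<open>run = k + l = 2 * t + 1\<close>, in which once-occurring symbols alternate with the \<open>t\<close> symbols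
  \<open>0, \<dots>, t - 1\<close>, followed by a block of length \<open>k\<close> that repeats \<open>0, \<dots>, t - 1\<close> in the same order,
  interspersed with new once-occurring symbols: the first \<open>l - 1\<close> entries are repetitions, and from
  there on new symbols and repetitions alternate. Keeping the order of the repeated symbols is what
  makes every window satisfy the spread condition.

  Among the first \<open>y\<close> entries of the block, \<open>fresh y\<close> are new; \<open>prefix_set a\<close> is the set of symbols
  occurring exactly once among the first \<open>a\<close> transitions.
\<close>

locale long_run_construction =
  fixes k l t :: nat
  assumes l_ge: "2 \<le> l" and k_ge: "2 * l + 1 \<le> k" and t_eq: "k + l = 2 * t + 1"
begin

abbreviation run :: nat where "run \<equiv> 2 * t + 1"
abbreviation half :: nat where "half \<equiv> run + k"
abbreviation dim :: nat where "dim \<equiv> t + k + 1"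

definition fresh :: "nat \<Rightarrow> nat" where "fresh y = (y + 2 - l) div 2"

text \<open>Of the symbols below \<open>t\<close>, the run has introduced those below
  \<open>hi a\<close> and the block has repeated those below \<open>lo a\<close>; the ones seen
  exactly once therefore form an interval.\<close>

definition lo :: "nat \<Rightarrow> nat" where
  "lo a = (if a \<le> run then 0 else a - run - fresh (a - run))"

definition hi :: "nat \<Rightarrow> nat" where
  "hi a = (if a \<le> run then a div 2 else t)"

definition single :: "nat \<Rightarrow> nat" where
  "single a = (if a \<le> run then t + (a + 1) div 2 else run + fresh (a - run))"

definition prefix_set :: "nat \<Rightarrow> nat set" where
  "prefix_set a = {lo a..<hi a} \<union> {t..<single a}"

text \<open>A block entry is new exactly when \<open>fresh\<close> increases; otherwise
  \<open>y - fresh y\<close> counts the repetitions so far and thus names the next symbol to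
  repeat.\<close>

definition symbol :: "nat \<Rightarrow> nat" where
  "symbol a =
     (if a < run then if even a then t + a div 2 else a div 2
      else let y = a - run in if fresh (Suc y) = fresh y then y - fresh y else run + fresh y)"

section \<open>Arithmetic of the counting functions\<close>

lemma fresh_le: "2 * fresh y \<le> y" "y < 2 * fresh y + l"
  using l_ge by (auto simp: fresh_def)

lemma fresh_k: "2 * fresh k + l = k + 1"
proof -
  have "k + 2 - l = 2 * (t + 1 - l) + 1" using t_eq k_ge by linarith
  then have "fresh k = t + 1 - l" by (simp add: fresh_def)
  then show ?thesis using t_eq k_ge by linarith
qed

lemma fresh_Suc: "fresh (Suc y) = fresh y \<or> fresh (Suc y) = Suc (fresh y)"
proof -
  define u where "u = y + 2 - l"
  have "Suc y + 2 - l = u \<or> Suc y + 2 - l = Suc u" unfolding u_def by linarith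
  moreover have "Suc u div 2 = u div 2 \<or> Suc u div 2 = Suc (u div 2)" by presburger
  ultimately show ?thesis unfolding fresh_def u_def[symmetric] by metis
qed

text \<open>In any stretch of the block, new symbols outnumber repetitions by at most one.\<close>

lemma fresh_diff: "x \<le> y \<Longrightarrow> 2 * fresh y \<le> 2 * fresh x + (y - x) + 1"
proof -
  assume "x \<le> y"
  define u v where "u = x + 2 - l" and "v = y + 2 - l"
  have "u \<le> v" "v - u \<le> y - x" using \<open>x \<le> y\<close> by (auto simp: u_def v_def)
  moreover have "2 * (v div 2) \<le> v" "u \<le> 2 * (u div 2) + 1" by presburger+
  moreover have "fresh x = u div 2" "fresh y = v div 2" by (simp_all add: fresh_def u_def v_def)
  ultimately show ?thesis by linarith
qed

lemma fresh_mono: "x \<le> y \<Longrightarrow> fresh x \<le> fresh y"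
  unfolding fresh_def by (simp add: div_le_mono)

lemma repeated_mono: "x \<le> y \<Longrightarrow> x - fresh x \<le> y - fresh y"
proof (induction y rule: dec_induct)
  case (step y)
  then show ?case using fresh_Suc[of y] fresh_le(1)[of y] by auto
qed simp

lemma repeated_le: "y \<le> k \<Longrightarrow> y - fresh y \<le> t"
  using repeated_mono[of y k] fresh_k t_eq by auto

lemma bounds_after_run:
  assumes "run \<le> a"
  shows "lo a = a - run - fresh (a - run)" "hi a = t" "single a = run + fresh (a - run)"
  using assms l_ge by (auto simp: lo_def hi_def single_def fresh_def)

lemma bounds_in_run:
  assumes "a \<le> run"
  shows "lo a = 0" "hi a = a div 2" "single a = t + (a + 1) div 2"
  using assms by (auto simp: lo_def hi_def single_def)

lemma hi_le: "hi a \<le> t"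
  by (auto simp: hi_def)

lemma single_bounds: "a \<le> half \<Longrightarrow> t \<le> single a \<and> single a \<le> dim"
proof -
  assume "a \<le> half"
  then have "fresh (a - run) \<le> fresh k" by (intro fresh_mono) simp
  then have "run + fresh (a - run) \<le> dim" using fresh_k t_eq by linarith
  then show ?thesis using k_ge t_eq by (auto simp: single_def)
qed

section \<open>Closed form of the prefix sets\<close>

lemma prefix_set_0: "prefix_set 0 = {}"
  by (simp add: prefix_set_def bounds_in_run)

lemma prefix_set_half: "prefix_set half = {t..<dim}"
proof -
  have "single half = run + fresh k" "lo half = k - fresh k" "hi half = t" by (simp_all add: bounds_after_run)
  moreover have "run + fresh k = dim" "k - fresh k = t" using fresh_k t_eq by linarith+
  ultimately have "single half = dim" "lo half = t" "hi half = t" by linarith+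
  then show ?thesis unfolding prefix_set_def by simp
qed

lemma prefix_set_subset: "a \<le> half \<Longrightarrow> prefix_set a \<subseteq> {..<dim}"
  using hi_le[of a] single_bounds[of a] by (auto simp: prefix_set_def)

text \<open>Each transition moves one endpoint by one: \<open>hi\<close> or \<open>single\<close>
  during the run, \<open>lo\<close> or \<open>single\<close> during the block.\<close>

lemma prefix_set_Suc:
  assumes "a < half"
  shows "c \<in> prefix_set (Suc a) \<longleftrightarrow> ((c \<in> prefix_set a) \<noteq> (c = symbol a))"
proof (cases "a < run")
  case True
  then have "Suc a \<le> run" "a \<le> run" by auto
  note e = bounds_in_run[OF this(1)] bounds_in_run[OF this(2)]
  show ?thesis
  proof (cases "even a")
    case True
    then obtain b where "a = 2 * b" by (rule evenE)
    then show ?thesis using e \<open>a < run\<close> by (auto simp: prefix_set_def symbol_def)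
  next
    case False
    then obtain b where "a = 2 * b + 1" by (rule oddE)
    then show ?thesis using e \<open>a < run\<close> by (auto simp: prefix_set_def symbol_def)
  qed
next
  case False
  then have "run \<le> Suc a" "run \<le> a" by auto
  note e = bounds_after_run[OF this(1)] bounds_after_run[OF this(2)]
  define y where "y = a - run"
  have y: "Suc a - run = Suc y" "a - run = y" "Suc y \<le> k" using False assms by (auto simp: y_def)
  have late_Suc: "lo (Suc a) = Suc y - fresh (Suc y)" "hi (Suc a) = t" "single (Suc a) = run + fresh (Suc y)"
    and late_a: "lo a = y - fresh y" "hi a = t" "single a = run + fresh y"
    using e unfolding y by auto
  have r: "Suc y - fresh (Suc y) \<le> t" "y - fresh y \<le> t" using y(3) by (auto intro!: repeated_le)
  have f: "fresh y \<le> y" using fresh_le(1)[of y] by simp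
  have sym: "symbol a = (if fresh (Suc y) = fresh y then y - fresh y else run + fresh y)"
    using False y by (simp add: symbol_def Let_def)
  define g where "g = y - fresh y"
  show ?thesis
  proof (cases "fresh (Suc y) = fresh y")
    case True
    then have "prefix_set (Suc a) = {Suc g..<t} \<union> {t..<run + fresh y}" "g < t"
      using f r(1) by (simp_all add: prefix_set_def late_Suc g_def Suc_diff_le)
    moreover have "prefix_set a = {g..<t} \<union> {t..<run + fresh y}" "symbol a = g"
      using True by (simp_all add: prefix_set_def late_a sym g_def)
    ultimately show ?thesis by auto
  next
    case False
    then have "fresh (Suc y) = Suc (fresh y)" using fresh_Suc by auto
    then have "prefix_set (Suc a) = {g..<t} \<union> {t..<run + Suc (fresh y)}"
      by (simp add: prefix_set_def late_Suc g_def)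
    moreover have "prefix_set a = {g..<t} \<union> {t..<run + fresh y}" "symbol a = run + fresh y"
      using False by (simp_all add: prefix_set_def late_a sym g_def)
    ultimately show ?thesis by auto
  qed
qed

lemma symbol_less:
  assumes "a < half"
  shows "symbol a < dim"
proof -
  have "symbol a \<in> prefix_set (Suc a) \<union> prefix_set a" using prefix_set_Suc[OF assms, of "symbol a"] by auto
  then show ?thesis
    using prefix_set_subset[of "Suc a"] prefix_set_subset[of a] assms by auto
qed

lemma inj_on_symbol: "inj_on symbol {0..<run}"
proof (rule inj_onI)
  fix a b assume ab: "a \<in> {0..<run}" "b \<in> {0..<run}" "symbol a = symbol b"
  have *: "even c \<and> symbol c = t + c div 2 \<or> odd c \<and> symbol c = c div 2 \<and> c div 2 < t"
    if "c < run" for c using that by (auto simp: symbol_def elim!: oddE)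
  show "a = b" using *[of a] *[of b] ab
    by (metis add_left_cancel atLeastLessThan_iff even_two_times_div_two not_add_less1 odd_two_times_div_two_succ)
qed

section \<open>The spread condition for prefix sets\<close>

definition overlap :: "nat \<Rightarrow> nat \<Rightarrow> nat" where
  "overlap a b = card (sym_diff {lo a..<hi a} {lo b..<hi b})"

lemma single_mono:
  assumes "a \<le> b"
  shows "single a \<le> single b"
proof -
  have "fresh (a - run) \<le> fresh (b - run)" using assms by (intro fresh_mono diff_le_mono)
  moreover have "(a + 1) div 2 \<le> (b + 1) div 2" using assms by (intro div_le_mono) simp
  moreover have "(a + 1) div 2 \<le> t + 1" if "a \<le> run" using that by linarith
  ultimately show ?thesis using assms unfolding single_def by (cases "a \<le> run"; cases "b \<le> run") simp_all
qed

text \<open>Symbols below \<open>t\<close> and once-occurring symbols are disjoint and counted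
  separately. The second set belongs to the complementary window, from \<open>b\<close> into the
  next half up to \<open>a\<close>.\<close>

lemma card_sym_diff_prefix_set:
  assumes "a \<le> b" "b \<le> half"
  shows "card (sym_diff (prefix_set a) (prefix_set b)) = overlap a b + (single b - single a)"
    and "card (sym_diff {t..<dim} (sym_diff (prefix_set a) (prefix_set b))) =
      overlap a b + (k + 1 - (single b - single a))"
proof -
  let ?P = "sym_diff {lo a..<hi a} {lo b..<hi b}"
  have s: "t \<le> single a" "single a \<le> single b" "single b \<le> dim"
    using assms single_bounds[of a] single_bounds[of b] single_mono by auto
  have P: "?P \<subseteq> {..<t}" using hi_le[of a] hi_le[of b] by auto
  have "sym_diff (prefix_set a) (prefix_set b) = ?P \<union> {single a..<single b}"
    using s hi_le[of a] hi_le[of b] by (auto simp: prefix_set_def)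
  moreover have "?P \<inter> {single a..<single b} = {}" using P s by auto
  ultimately show "card (sym_diff (prefix_set a) (prefix_set b)) = overlap a b + (single b - single a)"
    by (simp add: overlap_def card_Un_disjoint)
  have "sym_diff {t..<dim} (sym_diff (prefix_set a) (prefix_set b)) =
      ?P \<union> ({t..<single a} \<union> {single b..<dim})"
    using s hi_le[of a] hi_le[of b] by (auto simp: prefix_set_def)
  moreover have "?P \<inter> ({t..<single a} \<union> {single b..<dim}) = {}" using P s by auto
  moreover have "card ({t..<single a} \<union> {single b..<dim}) = k + 1 - (single b - single a)"
    using s by (subst card_Un_disjoint) auto
  ultimately show "card (sym_diff {t..<dim} (sym_diff (prefix_set a) (prefix_set b))) =
      overlap a b + (k + 1 - (single b - single a))"
    by (simp add: overlap_def card_Un_disjoint del: card_Un_disjnt)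
qed

text \<open>Because repetitions keep their order, one of the window from \<open>a\<close> to
  \<open>b\<close> and its complement is repetition-free, and the other has at least
  \<open>k\<close> odd symbols.\<close>

lemma prefix_set_spread:
  assumes "a \<le> b" "b \<le> half"
  defines "D \<equiv> sym_diff (prefix_set a) (prefix_set b)"
  shows "card D = b - a \<or> k \<le> card D"
    and "card (sym_diff {t..<dim} D) = half - (b - a) \<or> k \<le> card (sym_diff {t..<dim} D)"
proof -
  define S where "S = single b - single a"
  define w where "w = b - a"
  have w: "b = a + w" using assms by (simp add: w_def)
  have S: "single b = single a + S" using single_mono[OF assms(1)] by (simp add: S_def)
  have Sk: "S \<le> k + 1" using single_bounds[of a] single_bounds[of b] assms S by simp
  have card: "card D = overlap a b + S" "card (sym_diff {t..<dim} D) + S = overlap a b + k + 1"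
    using card_sym_diff_prefix_set[OF assms(1,2)] Sk by (simp_all add: D_def S_def)
  have "card D = w \<or> k \<le> card D"
    and "card (sym_diff {t..<dim} D) + w = half \<or> k \<le> card (sym_diff {t..<dim} D)"
  proof -
    consider (pre) "b \<le> run" | (post) "run \<le> a" | (mixed) "a \<le> run" "run \<le> b"
      using nat_le_linear[of b run] nat_le_linear[of a run] by blast
    then have "(card D = w \<or> k \<le> card D) \<and>
      (card (sym_diff {t..<dim} D) + w = half \<or> k \<le> card (sym_diff {t..<dim} D))"
    proof cases
      case pre
      then have "a \<le> run" using assms by simp
      note e = bounds_in_run[OF this] bounds_in_run[OF pre]
      have le: "a div 2 \<le> b div 2" using assms by (simp add: div_le_mono)
      have "sym_diff {0..<f} {0..<g} = {f..<g}" if "f \<le> g" for f g :: nat using that by auto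
      from this[OF le] have "sym_diff {0..<a div 2} {0..<b div 2} = {a div 2..<b div 2}" .
      then have "overlap a b + a div 2 = b div 2" using le by (simp add: overlap_def e)
      moreover have "(b + 1) div 2 = (a + 1) div 2 + S" using S unfolding e by simp
      ultimately have "overlap a b + S = w" "S \<le> overlap a b + 1"
        using w half_bounds[of a] half_bounds[of b] by linarith+
      then show ?thesis using card by linarith
    next
      case post
      then have "run \<le> b" using assms by simp
      note e0 = bounds_after_run[OF post] bounds_after_run[OF this]
      define x y where "x = a - run" and "y = b - run"
      note e = e0[folded x_def y_def]
      have xy: "a = run + x" "b = run + y" "x \<le> y" "y \<le> k"
        using post assms by (auto simp: x_def y_def)
      have r: "x - fresh x \<le> y - fresh y" "y - fresh y \<le> t"
        using repeated_mono repeated_le xy by auto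
      have "sym_diff {f..<t} {g..<t} = {f..<g}" if "f \<le> g" "g \<le> t" for f g using that by auto
      from this[OF r]
      have "sym_diff {x - fresh x..<t} {y - fresh y..<t} = {x - fresh x..<y - fresh y}" .
      then have o: "overlap a b + (x - fresh x) = y - fresh y"
        using r unfolding overlap_def e by simp
      have s: "fresh y = fresh x + S" using S by (simp add: e)
      \<comment> \<open>No symbol repeats inside the block, and \<open>fresh_diff\<close> limits the
        surplus of new symbols, which keeps the complement at \<open>k\<close> or more.\<close>
      have "overlap a b + S = w" "S \<le> overlap a b + 1"
        using o s xy w fresh_diff[OF xy(3)] fresh_le(1)[of x] fresh_le(1)[of y] by linarith+
      then show ?thesis using card by linarith
    next
      case mixed
      define y f where "y = b - run" and "f = a div 2"
      define r where "r = y - fresh y"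
      note e = bounds_in_run[OF mixed(1), folded f_def] bounds_after_run[OF mixed(2), folded y_def, folded r_def]
      have y: "b = run + y" "y \<le> k" using mixed assms by (auto simp: y_def)
      have f: "f \<le> t" "(a + 1) div 2 + f = a" "2 * f \<le> a" "a \<le> 2 * f + 1"
        using mixed by (auto simp: f_def)
      have ys: "y = r + fresh y" "fresh y \<le> r" "r < fresh y + l" "r \<le> t"
        using fresh_le[of y] repeated_le[OF y(2)] by (auto simp: r_def)
      have s: "S + (a + 1) div 2 = t + 1 + fresh y" using S unfolding e by simp
      \<comment> \<open>Before \<open>a\<close>, \<open>f\<close> of the symbols below
        \<open>t\<close> have entered; before \<open>b\<close>, \<open>r\<close> have been repeated.
        If r <= f, all repetitions in the window refer to entries before \<open>a\<close>; otherwise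
        the symbols from \<open>f\<close> to r - 1 cancel in the window and the complement has no
        repetition.\<close>
      show ?thesis
      proof (cases "r \<le> f")
        case True
        then have "sym_diff {0..<f} {r..<t} = {0..<r} \<union> {f..<t}" using f ys by auto
        then have o: "overlap a b + f = r + t"
          using True f by (simp add: overlap_def e card_Un_disjoint)
        have "card D = w" using o f(2) ys(1) s y(1) w card(1) by linarith
        moreover have "k \<le> card (sym_diff {t..<dim} D)" using o f(2-4) ys(1,2) s card(2) by linarith
        ultimately show ?thesis by blast
      next
        case False
        then have "sym_diff {0..<f} {r..<t} = {0..<f} \<union> {r..<t}" using f ys by auto
        then have o: "overlap a b + r = f + t"
          using False ys by (simp add: overlap_def e card_Un_disjoint)
        \<comment> \<open>Here card D = k + l - (r - fresh y) - (a mod 2), and r - fresh y <= l - 1: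
          the surplus of repetitions is as large as the spread allows.\<close>
        have "k \<le> card D" using o f(2-4) ys(1,3) s t_eq card(1) by linarith
        moreover have "card (sym_diff {t..<dim} D) + w = half"
          using o f(2) y(1) ys(1) s w card(2) by linarith
        ultimately show ?thesis by blast
      qed
    qed
    then show "card D = w \<or> k \<le> card D"
      and "card (sym_diff {t..<dim} D) + w = half \<or> k \<le> card (sym_diff {t..<dim} D)"
      by blast+
  qed
  then show "card D = b - a \<or> k \<le> card D"
    and "card (sym_diff {t..<dim} D) = half - (b - a) \<or> k \<le> card (sym_diff {t..<dim} D)"
    unfolding w_def by auto
qed

section \<open>The code: a half-turn toggles \<open>{t..<dim}\<close>\<close>

definition vertex_set :: "nat \<Rightarrow> nat set" where
  "vertex_set i =
     (if i < half then prefix_set i else sym_diff {t..<dim} (prefix_set (i - half)))"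

definition code :: "bool list list" where
  "code = map (\<lambda>i. map (\<lambda>c. c \<in> vertex_set i) [0..<dim]) [0..<2 * half]"

lemma length_code [simp]: "length code = 2 * half"
  unfolding code_def by (simp only: length_map length_upt diff_zero)

lemma code_nth:
  assumes "i < 2 * half"
  shows "code ! i = map (\<lambda>c. c \<in> vertex_set i) [0..<dim]"
  using assms unfolding code_def by (simp only: nth_map length_upt diff_zero nth_upt add_0)

lemma vertex_set_subset:
  assumes "i < 2 * half"
  shows "vertex_set i \<subseteq> {..<dim}"
proof (cases "i < half")
  case True
  then show ?thesis using prefix_set_subset[of i] by (simp add: vertex_set_def)
next
  case False
  have "i - half \<le> half" using assms by simp
  then have "prefix_set (i - half) \<subseteq> {..<dim}" by (rule prefix_set_subset)
  then show ?thesis using False unfolding vertex_set_def by auto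
qed

lemma vertex_set_Suc:
  assumes "i < 2 * half"
  shows "c \<in> vertex_set (Suc i mod (2 * half)) \<longleftrightarrow> ((c \<in> vertex_set i) \<noteq> (c = symbol (i mod half)))"
proof -
  consider (a) "Suc i < half" | (b) "Suc i = half" | (c) "half \<le> i" "Suc i < 2 * half"
    | (d) "Suc i = 2 * half"
    using assms by linarith
  then show ?thesis
  proof cases
    case a
    then have "Suc i mod (2 * half) = Suc i" "i mod half = i" "i < half" by simp_all
    then show ?thesis using a prefix_set_Suc[of i c] by (simp only: vertex_set_def if_True)
  next
    case b
    then have "Suc i mod (2 * half) = half" "i mod half = i" "i < half" by simp_all
    then show ?thesis using b prefix_set_Suc[of i c] prefix_set_half prefix_set_0
      by (simp only: vertex_set_def if_True if_False less_irrefl diff_self_eq_0) simp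
  next
    case c
    define a where "a = i - half"
    have a: "i = half + a" "Suc i - half = Suc a" "a < half" using c by (auto simp: a_def)
    then have "Suc i mod (2 * half) = Suc i" "\<not> i < half" "\<not> Suc i < half"
      using c by simp_all
    moreover have "i mod half = a" unfolding a(1) using a(3) by (simp only: mod_add_self1 mod_less)
    ultimately show ?thesis
      using a(2,3) prefix_set_Suc[of a c]
      by (simp only: vertex_set_def if_False a_def[symmetric]) auto
  next
    case d
    define a where "a = i - half"
    have a: "i = half + a" "Suc a = half" using d by (auto simp: a_def)
    have "Suc i mod (2 * half) = 0" unfolding d by (rule mod_self)
    moreover have "\<not> i < half" "0 < half" using a(1) by simp_all
    moreover have "i mod half = a"
      unfolding a(1) using a(2) by (simp only: mod_add_self1 mod_less lessI flip: a(2))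
    moreover have "c \<in> {t..<dim} \<longleftrightarrow> (c \<in> prefix_set a) \<noteq> (c = symbol a)"
      using prefix_set_Suc[of a c] prefix_set_half a by simp
    ultimately show ?thesis
      using prefix_set_0 by (simp only: vertex_set_def if_True if_False a_def[symmetric]) auto
  qed
qed

text \<open>Windows within one half use the first part of \<open>prefix_set_spread\<close>; those
  reaching the other half are complements of windows from \<open>a\<close> to \<open>b\<close> with
  r = half - (b - a) and use the second.\<close>

lemma vertex_set_spread:
  assumes "i < 2 * half" "r \<le> half"
  defines "D \<equiv> sym_diff (vertex_set i) (vertex_set ((i + r) mod (2 * half)))"
  shows "card D = r \<or> k \<le> card D"
proof -
  let ?V = "{t..<dim}"
  consider (a) "i + r < half" | (b) "i < half" "half \<le> i + r" | (c) "half \<le> i" "i + r < 2 * half"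
    | (d) "2 * half \<le> i + r"
    by linarith
  then show ?thesis
  proof cases
    case a
    then have "(i + r) mod (2 * half) = i + r" "i < half" by simp_all
    then have "D = sym_diff (prefix_set i) (prefix_set (i + r))"
      using a by (simp only: D_def vertex_set_def if_True)
    then show ?thesis using prefix_set_spread(1)[of i "i + r"] a by simp
  next
    case b
    define a where "a = i + r - half"
    have a: "a \<le> i" "half - (i - a) = r" "(i + r) mod (2 * half) = i + r"
      using b assms(2) by (auto simp: a_def)
    have "D = sym_diff (prefix_set i) (sym_diff ?V (prefix_set a))"
      using a(3) b by (simp only: D_def vertex_set_def if_True if_False not_less[symmetric] a_def not_not)
    then have "D = sym_diff ?V (sym_diff (prefix_set a) (prefix_set i))" by auto
    then show ?thesis using prefix_set_spread(2)[of a i] a b(1) by simp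
  next
    case c
    define a where "a = i - half"
    have a: "i + r - half = a + r" "a + r \<le> half" "(i + r) mod (2 * half) = i + r"
      "\<not> i < half" "\<not> i + r < half"
      using c by (auto simp: a_def)
    have "D = sym_diff (sym_diff ?V (prefix_set a)) (sym_diff ?V (prefix_set (a + r)))"
      using a by (simp only: D_def vertex_set_def if_False a_def[symmetric])
    then have "D = sym_diff (prefix_set a) (prefix_set (a + r))" by auto
    then show ?thesis using prefix_set_spread(1)[of a "a + r"] a by simp
  next
    case d
    define a b where "a = i + r - 2 * half" and "b = i - half"
    have ab: "a \<le> b" "b \<le> half" "half - (b - a) = r" "\<not> i < half" "a < half"
    proof -
      have "i + r - 2 * h \<le> i - h \<and> i - h \<le> h \<and> h - (i - h - (i + r - 2 * h)) = r \<and>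
          \<not> i < h \<and> i + r - 2 * h < h" if "2 * h \<le> i + r" "i < 2 * h" "r \<le> h" "0 < h" for h
        using that by auto
      from this[OF d assms(1,2)] show "a \<le> b" "b \<le> half" "half - (b - a) = r" "\<not> i < half" "a < half"
        unfolding a_def b_def by simp_all
    qed
    have "(i + r) mod (2 * half) = a"
      using d ab(5) unfolding a_def by (subst mod_if) (simp add: le_mod_geq)
    then have "D = sym_diff (sym_diff ?V (prefix_set b)) (prefix_set a)"
      using ab by (simp only: D_def vertex_set_def if_True if_False b_def[symmetric])
    then have "D = sym_diff ?V (sym_diff (prefix_set a) (prefix_set b))" by auto
    then show ?thesis using prefix_set_spread(2)[of a b] ab by simp
  qed
qed

lemma hamming_code:
  assumes "i < 2 * half" "j < 2 * half"
  shows "hamming (code ! i) (code ! j) = card (sym_diff (vertex_set i) (vertex_set j))"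
proof -
  have "{c. c < dim \<and> (c \<in> vertex_set i) \<noteq> (c \<in> vertex_set j)} = sym_diff (vertex_set i) (vertex_set j)"
    using vertex_set_subset assms by blast
  moreover have "{c. c < length (code ! i) \<and> code ! i ! c \<noteq> code ! j ! c} =
      {c. c < dim \<and> (c \<in> vertex_set i) \<noteq> (c \<in> vertex_set j)}"
    unfolding code_nth[OF assms(1)] code_nth[OF assms(2)] by (auto simp del: upt_Suc)
  ultimately show ?thesis by (simp only: hamming_def)
qed

lemma hamming_code_spread:
  assumes "i < 2 * half" "r \<le> half"
  shows "hamming (code ! i) (code ! ((i + r) mod (2 * half))) = r \<or>
    k \<le> hamming (code ! i) (code ! ((i + r) mod (2 * half)))"
  using vertex_set_spread[OF assms] hamming_code[OF assms(1), of "(i + r) mod (2 * half)"] by simp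

lemma code_flip:
  assumes "i < 2 * half"
  shows "length (code ! i) = dim" "symbol (i mod half) < dim"
    and "c < dim \<Longrightarrow>
      code ! (Suc i mod (2 * half)) ! c \<longleftrightarrow> (code ! i ! c \<noteq> (c = symbol (i mod half)))"
proof -
  have S: "Suc i mod (2 * half) < 2 * half" by (intro mod_less_divisor) simp
  show "length (code ! i) = dim" unfolding code_nth[OF assms] by (simp del: upt_Suc)
  show "symbol (i mod half) < dim" by (intro symbol_less mod_less_divisor) simp
  show "code ! (Suc i mod (2 * half)) ! c \<longleftrightarrow> (code ! i ! c \<noteq> (c = symbol (i mod half)))" if "c < dim"
    using vertex_set_Suc[OF assms, of c] that
    unfolding code_nth[OF assms] code_nth[OF S]
    by (simp only: nth_map length_upt diff_zero nth_upt add_0)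
qed

lemma transition_code:
  assumes "i < 2 * half"
  shows "transition code i = symbol (i mod half)"
  by (rule transition_eqI) (use code_flip[OF assms] in \<open>simp_all only: length_code\<close>)

lemma simple_cycle_code: "simple_cycle (hypercube dim) code"
  unfolding simple_cycle_def
proof (intro conjI allI impI)
  show "3 \<le> length code" using k_ge l_ge by simp
  show "distinct code"
    unfolding distinct_conv_nth length_code
  proof (intro allI impI)
    fix i j assume ij: "i < 2 * half" "j < 2 * half" "i \<noteq> j"
    \<comment> \<open>Distinctness follows from the spread: different indices give r > 0, and a
      Hamming distance equal to r or at least k is then positive.\<close>
    have k: "k > 0" using k_ge by simp
    obtain a b r where "a = i \<and> b = j \<or> a = j \<and> b = i" "0 < r" "r \<le> half"
        "a < 2 * half" "b = (a + r) mod (2 * half)"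
      using cyclic_offset[OF ij(1,2)] ij by (metis mod_less add_0_right gr0I)
    then have "hamming (code ! a) (code ! b) > 0"
      using hamming_code_spread[of a r] k by auto
    moreover have "hamming u u = 0" for u by (simp add: hamming_def)
    ultimately have "code ! a \<noteq> code ! b" by (metis less_irrefl)
    then show "code ! i \<noteq> code ! j" using \<open>a = i \<and> b = j \<or> a = j \<and> b = i\<close> by auto
  qed
  fix i assume "i < length code"
  then have i: "i < 2 * half" by (simp only: length_code)
  have S: "Suc i mod (2 * half) < 2 * half" by (intro mod_less_divisor) simp
  show "(code ! i, code ! (Suc i mod length code)) \<in> hypercube dim"
    unfolding length_code
    by (rule hypercube_flipI[OF code_flip(1)[OF i] code_flip(1)[OF S] code_flip(2,3)[OF i]])
qed

lemma circuit_code_code: "circuit_code dim k code"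
proof (rule circuit_codeI[OF simple_cycle_code])
  fix i r assume "i < length code" "2 * r \<le> length code"
  then show "hamming (code ! i) (code ! ((i + r) mod length code)) = r \<or>
      k \<le> hamming (code ! i) (code ! ((i + r) mod length code))"
    unfolding length_code by (intro hamming_code_spread) simp_all
qed

lemma symmetric_code_code: "symmetric_code code"
  unfolding symmetric_code_def Let_def transitions_def length_map length_upt length_code diff_zero
proof (intro allI impI)
  fix i assume "i < 2 * half div 2"
  then have i: "i < half" by simp
  then have "transition code (i + half) = symbol ((i + half) mod half)"
    by (intro transition_code) simp
  then have "transition code i = transition code (i + half)"
    using transition_code[of i] i by (simp only: mod_add_self2) simp
  then show "map (transition code) [0..<2 * half] ! i =
      map (transition code) [0..<2 * half] ! (i + 2 * half div 2)"
    using i by (simp del: upt_Suc)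
qed

lemma max_bit_run_code: "run \<le> max_bit_run code"
proof -
  let ?T = "transitions code"
  have "take run ?T = map symbol [0..<run]"
  proof (rule nth_equalityI)
    show "length (take run ?T) = length (map symbol [0..<run])"
      unfolding transitions_def length_take length_map length_upt length_code by simp
    fix i assume "i < length (take run ?T)"
    then have "i < run" by simp
    then show "take run ?T ! i = map symbol [0..<run] ! i"
      using transition_code[of i] by (simp add: transitions_def del: upt_Suc)
  qed
  then have "take run (rotate 0 ?T) = map symbol [0..<run]" by simp
  moreover have "distinct (map symbol [0..<run])"
    using inj_on_symbol unfolding distinct_map set_upt by (simp only: distinct_upt simp_thms)
  ultimately have "run \<in> {length S | S. S \<in> segments ?T \<and> distinct S}"
    unfolding segments_def
    by (intro CollectI exI[of _ "map symbol [0..<run]"] conjI) (metis length_map length_upt diff_zero | blast)+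
  then show ?thesis unfolding max_bit_run_def using finite_bit_runs by (rule Max_ge[rotated])
qed

end

theorem theorem3p9:
  fixes d k l :: nat
  assumes "odd k" and "even l" and "l \<ge> 2" and "k \<ge> 2 * l + 1"
    and "real d = 3 * real k / 2 + (real l + 1) / 2"
  shows "(\<exists>C \<in> circuit_codes d k (k + l). symmetric_code C \<and> length C = 4 * k + 2 * l)
    \<and> (\<forall>C \<in> circuit_codes d k (k + l). symmetric_code C \<longrightarrow> length C \<le> 4 * k + 2 * l)"
proof
  have d: "2 * d = 3 * k + l + 1" using assms(5) proof -
    have "real (2 * d) = real (3 * k + l + 1)" using assms(5) by simp
    then show ?thesis by (simp only: of_nat_eq_iff)
  qed
  have "odd (k + l)" using assms(1,2) by simp
  then obtain t where t: "k + l = 2 * t + 1" by (rule oddE)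
  interpret long_run_construction k l t
    using assms t by unfold_locales
  \<comment> \<open>From k + l = 2t + 1 one gets 2(t + k + 1) = 3k + l + 1 = 2d.\<close>
  have "dim = d" using d t by linarith
  then have "circuit_code d k code" using circuit_code_code by simp
  moreover have "k + l \<le> max_bit_run code" using max_bit_run_code t by simp
  ultimately have "code \<in> circuit_codes d k (k + l)" by (simp add: circuit_codes_def)
  moreover have "length code = 4 * k + 2 * l" using t by simp
  ultimately show "\<exists>C \<in> circuit_codes d k (k + l). symmetric_code C \<and> length C = 4 * k + 2 * l"
    using symmetric_code_code by blast
  show "\<forall>C \<in> circuit_codes d k (k + l). symmetric_code C \<longrightarrow> length C \<le> 4 * k + 2 * l"
    using symmetric_code_length_le[OF assms(1-4) d] by blast
qed

end
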